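(* Let $W\in\mathbb{C}[x_1,\dots,x_n]$ be an admissible polynomial with $m\times n$ exponent matrix $A$, and let $S$ be the Smith normal form of $A$. Let $G_W^{\text{Smith}} = \{\mathbf{g}\in(\mathbb{Q}/\mathbb{Z})^n \mid S\mathbf{g}\in\mathbb{Z}^m\}$. Then $G_W^{\text{Smith}} \cong G_W^{\max}$ as finite Abelian groups.
   Context: A polynomial $W \in \mathbb{C}[x_1,\dots,x_n]$ is nondegenerate if it has an isolated critical point at the origin. It is quasihomogeneous if there are positive rational numbers $q_1,\dots,q_n$ (the weights) with $W(c^{q_1}x_1,\dots,c^{q_n}x_n) = cW(x_1,\dots,x_n)$ for all $c\in\mathbb{C}$; equivalently, every monomial $x_1^{a_1}\cdots x_n^{a_n}$ of $W$ satisfies $\sum_j a_j q_j = 1$. $W$ is admissible if it is nondegenerate, quasihomogeneous with unique weights, and has no monomials of the form $x_i x_j$ with $i \neq j$. Writing $W = \sum_{i=1}^m c_i \prod_{j=1}^n x_j^{a_{ij}}$ as a sum of its $m$ distinct monomials (with $c_i\neq 0$), the exponent matrix of $W$ is the $m\times n$ matrix $A = (a_{ij})$. For admissible $W$ one has $m\ge n$ and $A$ has rank $n$. The maximal symmetry group of $W$, in additive notation, is $G_W^{\max} = \{\mathbf{g}\in(\mathbb{Q}/\mathbb{Z})^n \mid A\mathbf{g}\in\mathbb{Z}^m\}$ (a subgroup of $(\mathbb{Q}/\mathbb{Z})^n$ under coordinate-wise addition; the condition does not depend on representatives in $\mathbb{Q}^n$). The Smith normal form of an $m\times n$ integer matrix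 $M$ of rank $n$ is the $m\times n$ integer matrix $S = PMQ$, where $P$ is an $m\times m$ matrix invertible over $\mathbb{Z}$, $Q$ is an $n\times n$ matrix invertible over $\mathbb{Z}$, the first $n$ rows of $S$ form the diagonal matrix $\mathrm{diag}(a_1,\dots,a_n)$ with positive integers $a_i$ satisfying $a_{i-1}\mid a_i$ for $2\le i\le n$, and the remaining $m-n$ rows of $S$ are zero. The $a_i$ are called the invariant factors. *)

theory Defs
  imports
    "HOL-Analysis.Complex_Transcendental"
    "HOL-Library.Poly_Mapping"
    "HOL-Algebra.Product_Groups"
    "Jordan_Normal_Form.Matrix"
begin

unbundle no vec_syntax

section \<open>Admissible polynomials\<close>

text \<open>
  A polynomial over the complex numbers is a finitely supported map from monomials to coefficients,
  a monomial being the finitely supported map from variable indices to exponents.  The variables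
  \<open>x\<^sub>1, \<dots>, x\<^sub>n\<close> are numbered \<open>0, \<dots>, n - 1\<close>.
\<close>

type_synonym cpoly = "(nat \<Rightarrow>\<^sub>0 nat) \<Rightarrow>\<^sub>0 complex"

definition poly_in_vars :: "nat \<Rightarrow> cpoly \<Rightarrow> bool" where
  "poly_in_vars n W \<longleftrightarrow> (\<forall>a \<in> Poly_Mapping.keys W. Poly_Mapping.keys a \<subseteq> {..<n})"

definition eval_cpoly :: "cpoly \<Rightarrow> (nat \<Rightarrow> complex) \<Rightarrow> complex" where
  "eval_cpoly W x = (\<Sum>a \<in> Poly_Mapping.keys W.
     Poly_Mapping.lookup W a * (\<Prod>j \<in> Poly_Mapping.keys a. x j ^ Poly_Mapping.lookup a j))"

text \<open>
  A point of \<open>\<complex>\<^sup>n\<close> is given by the values \<open>x j\<close> for \<open>j < n\<close>; for a polynomial in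
  \<open>n\<close> variables the other values play no role below.
\<close>

definition critical_point :: "nat \<Rightarrow> cpoly \<Rightarrow> (nat \<Rightarrow> complex) \<Rightarrow> bool" where
  "critical_point n W x \<longleftrightarrow>
     (\<forall>j<n. ((\<lambda>z. eval_cpoly W (x(j := z))) has_field_derivative 0) (at (x j)))"

definition nondegenerate :: "nat \<Rightarrow> cpoly \<Rightarrow> bool" where
  "nondegenerate n W \<longleftrightarrow>
     critical_point n W (\<lambda>_. 0) \<and>
     (\<exists>e>0. \<forall>x. (\<forall>j<n. norm (x j) < e) \<and> critical_point n W x \<longrightarrow> (\<forall>j<n. x j = 0))"

text \<open>
  The rational powers \<open>c\<^bsup>q\<^esup>\<close> are principal values, with \<open>0\<^bsup>q\<^esup> = 0\<close> for \<open>q > 0\<close>.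
\<close>

definition is_weights :: "nat \<Rightarrow> cpoly \<Rightarrow> (nat \<Rightarrow> rat) \<Rightarrow> bool" where
  "is_weights n W q \<longleftrightarrow>
     (\<forall>j<n. 0 < q j) \<and>
     (\<forall>c x. eval_cpoly W (\<lambda>j. c powr of_rat (q j) * x j) = c * eval_cpoly W x)"

definition quasihomogeneous :: "nat \<Rightarrow> cpoly \<Rightarrow> bool" where
  "quasihomogeneous n W \<longleftrightarrow> (\<exists>q. is_weights n W q)"

definition unique_weights :: "nat \<Rightarrow> cpoly \<Rightarrow> bool" where
  "unique_weights n W \<longleftrightarrow>
     (\<forall>q q'. is_weights n W q \<and> is_weights n W q' \<longrightarrow> (\<forall>j<n. q j = q' j))"

definition admissible :: "nat \<Rightarrow> cpoly \<Rightarrow> bool" where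
  "admissible n W \<longleftrightarrow>
     poly_in_vars n W \<and> nondegenerate n W \<and> quasihomogeneous n W \<and> unique_weights n W \<and>
     (\<forall>i<n. \<forall>j<n. i \<noteq> j \<longrightarrow>
       Poly_Mapping.single i 1 + Poly_Mapping.single j 1 \<notin> Poly_Mapping.keys W)"

section \<open>Exponent matrices and Smith normal form\<close>

text \<open>
  The rows of an exponent matrix are the exponent vectors of the distinct monomials, in any order;
  so there is one exponent matrix for each enumeration of the monomials.
\<close>

definition is_exponent_matrix :: "nat \<Rightarrow> cpoly \<Rightarrow> int mat \<Rightarrow> bool" where
  "is_exponent_matrix n W A \<longleftrightarrow>
     (\<exists>ms. distinct ms \<and> set ms = Poly_Mapping.keys W \<and>
           A = mat (length ms) n (\<lambda>(i, j). int (Poly_Mapping.lookup (ms ! i) j)))"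

text \<open>
  The shape of \<open>S\<close> forces \<open>dim_col M \<le> dim_row M\<close> and \<open>M\<close> to have full column rank.
\<close>

definition is_smith_normal_form :: "int mat \<Rightarrow> int mat \<Rightarrow> bool" where
  "is_smith_normal_form M S \<longleftrightarrow>
     (let m = dim_row M; n = dim_col M in
       n \<le> m \<and>
       (\<exists>P \<in> carrier_mat m m. \<exists>Q \<in> carrier_mat n n.
          invertible_mat P \<and> invertible_mat Q \<and> S = P * M * Q) \<and>
       (\<exists>a :: nat \<Rightarrow> int.
          (\<forall>i<n. 0 < a i) \<and>
          (\<forall>i. Suc i < n \<longrightarrow> a i dvd a (Suc i)) \<and>
          S = mat m n (\<lambda>(i, j). if i = j then a i else 0)))"

section \<open>Symmetry groups\<close>

definition rat_add_group :: "rat monoid" where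
  "rat_add_group = \<lparr>carrier = UNIV, monoid.mult = (+), one = 0\<rparr>"

definition rat_mod_int :: "rat set monoid" where
  "rat_mod_int = rat_add_group Mod \<int>"

text \<open>
  The group of all \<open>g\<close> in \<open>(\<rat>/\<int>)\<^sup>n\<close> with \<open>B g\<close> integral, where \<open>n\<close> is the number of columns of \<open>B\<close>.
  An element of \<open>(\<rat>/\<int>)\<^sup>n\<close> is a family of cosets; \<open>B g\<close> is computed with a representative \<open>r\<close> in
  \<open>\<rat>\<^sup>n\<close>, and integrality does not depend on which one.
\<close>

definition symmetry_set :: "int mat \<Rightarrow> (nat \<Rightarrow> rat set) set" where
  "symmetry_set B =
     {g \<in> carrier (product_group {..<dim_col B} (\<lambda>_. rat_mod_int)).
        \<exists>r \<in> carrier_vec (dim_col B). (\<forall>j<dim_col B. r $ j \<in> g j) \<and>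
          (\<forall>i<dim_row B. (map_mat of_int B *\<^sub>v r) $ i \<in> \<int>)}"

definition symmetry_group :: "int mat \<Rightarrow> (nat \<Rightarrow> rat set) monoid" where
  "symmetry_group B =
     (product_group {..<dim_col B} (\<lambda>_. rat_mod_int))\<lparr>carrier := symmetry_set B\<rparr>"

lemma rat_add_group_coset: "\<int> #>\<^bsub>rat_add_group\<^esub> x = {z + x | z. z \<in> \<int>}"
  by (auto simp: r_coset_def rat_add_group_def)

lemma symmetry_set_all_representatives:
  "symmetry_set B =
     {g \<in> carrier (product_group {..<dim_col B} (\<lambda>_. rat_mod_int)).
        \<forall>r \<in> carrier_vec (dim_col B). (\<forall>j<dim_col B. r $ j \<in> g j) \<longrightarrow>
          (\<forall>i<dim_row B. (map_mat of_int B *\<^sub>v r) $ i \<in> \<int>)}"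
proof -
  let ?n = "dim_col B"
  have coset: "\<exists>x. g j = {z + x | z. z \<in> \<int>}"
    if "g \<in> carrier (product_group {..<?n} (\<lambda>_. rat_mod_int))" "j < ?n" for g j
    using that
    by (auto simp: rat_mod_int_def FactGroup_def RCOSETS_def rat_add_group_coset PiE_def Pi_def) blast
  have indep: "(map_mat of_int B *\<^sub>v s) $ i \<in> \<int>"
    if g: "g \<in> carrier (product_group {..<?n} (\<lambda>_. rat_mod_int))"
      and r: "r \<in> carrier_vec ?n" "\<forall>j<?n. r $ j \<in> g j"
      and s: "s \<in> carrier_vec ?n" "\<forall>j<?n. s $ j \<in> g j"
      and i: "i < dim_row B" and int: "(map_mat of_int B *\<^sub>v r) $ i \<in> \<int>"
    for g i and r s :: "rat Matrix.vec"
  proof -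
    have d: "s $ j - r $ j \<in> \<int>" if j: "j < ?n" for j
    proof -
      obtain x where x: "g j = {z + x | z. z \<in> \<int>}" using coset[OF g j] by blast
      have "r $ j \<in> g j" "s $ j \<in> g j" using r(2) s(2) j by simp_all
      then obtain z z' where "z \<in> \<int>" "z' \<in> \<int>" "r $ j = z + x" "s $ j = z' + x"
        unfolding x by auto
      then show ?thesis by simp
    qed
    have "(map_mat of_int B *\<^sub>v s) $ i - (map_mat of_int B *\<^sub>v r) $ i =
        (\<Sum>j<?n. of_int (B $$ (i, j)) * (s $ j - r $ j))"
      using r s i
      by (simp add: scalar_prod_def algebra_simps sum_subtractf atLeast0LessThan)
    also have "\<dots> \<in> \<int>" using d by (intro Ints_sum Ints_mult) auto
    finally show ?thesis using int by (metis Ints_add diff_add_cancel)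
  qed
  have ex: "\<exists>r \<in> carrier_vec ?n. \<forall>j<?n. r $ j \<in> g j"
    if g: "g \<in> carrier (product_group {..<?n} (\<lambda>_. rat_mod_int))" for g
  proof -
    have "\<exists>x. x \<in> g j" if j: "j < ?n" for j
    proof -
      obtain x where "g j = {z + x | z. z \<in> \<int>}" using coset[OF g j] by blast
      then have "0 + x \<in> g j" by (auto intro!: exI[of _ 0])
      then show ?thesis by blast
    qed
    then have "\<forall>j<?n. (SOME x. x \<in> g j) \<in> g j" by (simp add: some_in_eq ex_in_conv[symmetric])
    then show ?thesis by (intro bexI[of _ "Matrix.vec ?n (\<lambda>j. SOME x. x \<in> g j)"]) auto
  qed
  show ?thesis
    unfolding symmetry_set_def
  proof (rule Collect_cong, rule conj_cong, rule refl)
    fix g assume g: "g \<in> carrier (product_group {..<?n} (\<lambda>_. rat_mod_int))"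
    let ?I = "\<lambda>r. \<forall>i<dim_row B. (map_mat of_int B *\<^sub>v r) $ i \<in> \<int>"
    show "(\<exists>r \<in> carrier_vec ?n. (\<forall>j<?n. r $ j \<in> g j) \<and> ?I r) \<longleftrightarrow>
          (\<forall>r \<in> carrier_vec ?n. (\<forall>j<?n. r $ j \<in> g j) \<longrightarrow> ?I r)"
      (is "?L \<longleftrightarrow> ?R")
    proof
      assume ?L
      then obtain r where r: "r \<in> carrier_vec ?n" "\<forall>j<?n. r $ j \<in> g j" "?I r" by blast
      show ?R
      proof (intro ballI impI allI)
        fix s i assume "s \<in> carrier_vec ?n" "\<forall>j<?n. s $ j \<in> g j" "i < dim_row B"
        then show "(map_mat of_int B *\<^sub>v s) $ i \<in> \<int>"
          using indep[OF g r(1,2)] r(3) by simp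
      qed
    next
      assume R: ?R
      obtain r where "r \<in> carrier_vec ?n" "\<forall>j<?n. r $ j \<in> g j" using ex[OF g] by blast
      with R show ?L by (intro bexI[of _ r]) simp_all
    qed
  qed
qed

end

(*
  Write S = P A Q with P and Q invertible over the integers.  As P and its inverse preserve
  integral vectors, S r is integral exactly when A (Q r) is, so r |-> Q r carries the vectors
  defining the group of S onto those defining the group of A.  As Q and its inverse preserve
  integral vectors as well, this map descends to an isomorphism modulo Z^n.  Finiteness is read
  off from S: there the condition a_j g_j = 0 leaves finitely many values for each coordinate.
*)

theory Submission
  imports Defs
begin

section \<open>Rational vectors and their classes modulo integral vectors\<close>

abbreviation rat_mat :: "int mat \<Rightarrow> rat mat" where
  "rat_mat \<equiv> map_mat of_int"

definition integral_vec :: "rat Matrix.vec \<Rightarrow> bool" where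
  "integral_vec v \<longleftrightarrow> (\<forall>i<dim_vec v. v $ i \<in> \<int>)"

text \<open>This is the projection from rational vectors of dimension n onto the n-th power of Q/Z.
  The restriction to indices below the dimension is there because carriers of
  \<open>product_group\<close> consist of extensional functions.\<close>

definition coset_vec :: "rat Matrix.vec \<Rightarrow> nat \<Rightarrow> rat set" where
  "coset_vec r = (\<lambda>j\<in>{..<dim_vec r}. \<int> #>\<^bsub>rat_add_group\<^esub> (r $ j))"

section \<open>The group Q/Z\<close>

lemma comm_group_rat_add_group: "comm_group rat_add_group"
proof (rule comm_groupI)
  fix x :: rat
  show "\<exists>y\<in>carrier rat_add_group. y \<otimes>\<^bsub>rat_add_group\<^esub> x = \<one>\<^bsub>rat_add_group\<^esub>"
    by (auto simp: rat_add_group_def intro!: exI[of _ "- x"])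
qed (auto simp: rat_add_group_def)

lemma subgroup_Ints_rat_add_group: "subgroup \<int> rat_add_group"
proof -
  interpret comm_group rat_add_group by (rule comm_group_rat_add_group)
  show ?thesis
  proof (rule subgroupI)
    fix a :: rat assume a: "a \<in> \<int>"
    have "inv\<^bsub>rat_add_group\<^esub> a = - a"
      by (rule inv_equality) (auto simp: rat_add_group_def)
    with a show "inv\<^bsub>rat_add_group\<^esub> a \<in> \<int>" by simp
  qed (auto simp: rat_add_group_def)
qed

lemma comm_group_rat_mod_int: "comm_group rat_mod_int"
  unfolding rat_mod_int_def
  by (rule comm_group.abelian_FactGroup[OF comm_group_rat_add_group subgroup_Ints_rat_add_group])

lemma carrier_rat_mod_int: "carrier rat_mod_int = range (\<lambda>x. \<int> #>\<^bsub>rat_add_group\<^esub> x)"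
  by (auto simp: rat_mod_int_def FactGroup_def RCOSETS_def rat_add_group_def)

text \<open>The factor group multiplies cosets as sets; normality of \<open>\<int>\<close> lets
  representatives be added instead.\<close>

lemma mult_rat_mod_int:
  "(\<int> #>\<^bsub>rat_add_group\<^esub> x) \<otimes>\<^bsub>rat_mod_int\<^esub> (\<int> #>\<^bsub>rat_add_group\<^esub> y) = \<int> #>\<^bsub>rat_add_group\<^esub> (x + y)"
proof -
  interpret comm_group rat_add_group by (rule comm_group_rat_add_group)
  have "\<int> \<lhd> rat_add_group"
    using subgroup_Ints_rat_add_group by (rule subgroup_imp_normal)
  from normal.rcos_sum[OF this, of x y] show ?thesis
    by (simp add: rat_mod_int_def FactGroup_def rat_add_group_def)
qed

lemma Ints_coset_eq_iff:
  "\<int> #>\<^bsub>rat_add_group\<^esub> x = \<int> #>\<^bsub>rat_add_group\<^esub> y \<longleftrightarrow> x - y \<in> \<int>"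
proof
  assume "\<int> #>\<^bsub>rat_add_group\<^esub> x = \<int> #>\<^bsub>rat_add_group\<^esub> y"
  moreover have "x \<in> \<int> #>\<^bsub>rat_add_group\<^esub> x"
    unfolding rat_add_group_coset by (auto intro!: exI[of _ 0])
  ultimately show "x - y \<in> \<int>" by (auto simp: rat_add_group_coset)
next
  assume d: "x - y \<in> \<int>"
  have sub: "\<int> #>\<^bsub>rat_add_group\<^esub> a \<subseteq> \<int> #>\<^bsub>rat_add_group\<^esub> b" if "a - b \<in> \<int>" for a b :: rat
  proof
    fix t assume "t \<in> \<int> #>\<^bsub>rat_add_group\<^esub> a"
    then obtain z where "z \<in> \<int>" "t = z + a" by (auto simp: rat_add_group_coset)
    with that show "t \<in> \<int> #>\<^bsub>rat_add_group\<^esub> b"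
      by (auto simp: rat_add_group_coset intro!: exI[of _ "z + (a - b)"])
  qed
  from d have "y - x \<in> \<int>" by (metis Ints_minus minus_diff_eq)
  with d show "\<int> #>\<^bsub>rat_add_group\<^esub> x = \<int> #>\<^bsub>rat_add_group\<^esub> y" by (intro equalityI sub)
qed

section \<open>Powers of Q/Z as quotients of rational vectors\<close>

text \<open>Choosing a representative in every coordinate shows that the projection is onto, so
  arguments about families of cosets reduce to arguments about vectors.\<close>

lemma carrier_rat_mod_int_power:
  "carrier (product_group {..<n} (\<lambda>_. rat_mod_int)) = coset_vec ` carrier_vec n"
proof (rule equalityI)
  show "coset_vec ` carrier_vec n \<subseteq> carrier (product_group {..<n} (\<lambda>_. rat_mod_int))"
    by (auto simp: coset_vec_def carrier_rat_mod_int)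
  show "carrier (product_group {..<n} (\<lambda>_. rat_mod_int)) \<subseteq> coset_vec ` carrier_vec n"
  proof
    fix g assume g: "g \<in> carrier (product_group {..<n} (\<lambda>_. rat_mod_int))"
    then have "\<forall>j\<in>{..<n}. \<exists>x. g j = \<int> #>\<^bsub>rat_add_group\<^esub> x"
      by (auto simp: carrier_rat_mod_int PiE_def Pi_def)
    then obtain r where r: "\<forall>j\<in>{..<n}. g j = \<int> #>\<^bsub>rat_add_group\<^esub> (r j)" by metis
    have "g = coset_vec (Matrix.vec n r)"
      using g r by (intro ext) (auto simp: coset_vec_def PiE_def extensional_def)
    then show "g \<in> coset_vec ` carrier_vec n" by auto
  qed
qed

lemma mult_coset_vec:
  assumes "r \<in> carrier_vec n" "s \<in> carrier_vec n"
  shows "coset_vec r \<otimes>\<^bsub>product_group {..<n} (\<lambda>_. rat_mod_int)\<^esub> coset_vec s = coset_vec (r + s)"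
  using assms by (intro ext) (auto simp: coset_vec_def mult_rat_mod_int)

lemma coset_vec_eq_iff:
  assumes "r \<in> carrier_vec n" "s \<in> carrier_vec n"
  shows "coset_vec r = coset_vec s \<longleftrightarrow> integral_vec (r - s)"
  using assms
  by (auto simp: coset_vec_def integral_vec_def Ints_coset_eq_iff[symmetric] fun_eq_iff restrict_def)

text \<open>Links the coordinatewise membership used in \<open>symmetry_set\<close> with equality of
  classes: both say that \<open>r - s\<close> is integral.\<close>

lemma mem_coset_vec_iff:
  assumes "r \<in> carrier_vec n" "s \<in> carrier_vec n"
  shows "(\<forall>j<n. r $ j \<in> coset_vec s j) \<longleftrightarrow> coset_vec r = coset_vec s"
proof -
  have "x \<in> \<int> #>\<^bsub>rat_add_group\<^esub> y \<longleftrightarrow> x - y \<in> \<int>" for x y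
    by (force simp: rat_add_group_coset intro: exI[of _ "x - y"])
  then show ?thesis
    unfolding coset_vec_eq_iff[OF assms] using assms by (auto simp: coset_vec_def integral_vec_def)
qed

section \<open>Symmetry groups described by rational vectors\<close>

lemma integral_vec_add:
  "integral_vec u \<Longrightarrow> integral_vec v \<Longrightarrow> dim_vec u = dim_vec v \<Longrightarrow> integral_vec (u + v)"
  by (auto simp: integral_vec_def)

text \<open>Every entry of the product is a sum of products of integers. This serves twice: for
  matrices acting on the left of \<open>A\<close> and for the change of representatives on the
  right.\<close>

lemma integral_vec_mult_mat_vec:
  assumes "dim_col B = dim_vec v" "integral_vec v"
  shows "integral_vec (rat_mat B *\<^sub>v v)"
  using assms by (auto simp: integral_vec_def scalar_prod_def intro!: Ints_sum Ints_mult)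

lemma symmetry_set_eq:
  "symmetry_set B = coset_vec ` {r \<in> carrier_vec (dim_col B). integral_vec (rat_mat B *\<^sub>v r)}"
proof -
  have "g \<in> symmetry_set B \<longleftrightarrow>
      (\<exists>r \<in> carrier_vec (dim_col B). g = coset_vec r \<and> integral_vec (rat_mat B *\<^sub>v r))" for g
  proof
    assume "g \<in> symmetry_set B"
    then obtain s r where "s \<in> carrier_vec (dim_col B)" "g = coset_vec s"
        and r: "r \<in> carrier_vec (dim_col B)" "\<forall>j<dim_col B. r $ j \<in> g j"
          "\<forall>i<dim_row B. (rat_mat B *\<^sub>v r) $ i \<in> \<int>"
      unfolding symmetry_set_def carrier_rat_mod_int_power by blast
    then have "g = coset_vec r" using mem_coset_vec_iff by metis
    with r show "\<exists>r \<in> carrier_vec (dim_col B). g = coset_vec r \<and> integral_vec (rat_mat B *\<^sub>v r)"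
      by (auto simp: integral_vec_def)
  next
    assume "\<exists>r \<in> carrier_vec (dim_col B). g = coset_vec r \<and> integral_vec (rat_mat B *\<^sub>v r)"
    then obtain r where r: "r \<in> carrier_vec (dim_col B)" "g = coset_vec r"
        "integral_vec (rat_mat B *\<^sub>v r)" by blast
    then show "g \<in> symmetry_set B"
      unfolding symmetry_set_def carrier_rat_mod_int_power
      using mem_coset_vec_iff[OF r(1) r(1)] by (auto simp: integral_vec_def)
  qed
  then show ?thesis by blast
qed

lemma carrier_symmetry_group [simp]: "carrier (symmetry_group B) = symmetry_set B"
  by (simp add: symmetry_group_def)

lemma mult_symmetry_group:
  "r \<in> carrier_vec (dim_col B) \<Longrightarrow> s \<in> carrier_vec (dim_col B) \<Longrightarrow>
     coset_vec r \<otimes>\<^bsub>symmetry_group B\<^esub> coset_vec s = coset_vec (r + s)"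
  using mult_coset_vec[of r "dim_col B" s] by (simp add: symmetry_group_def)

text \<open>The vectors with integral image under \<open>B\<close> are closed under addition and
  negation and contain zero, since \<open>B\<close> acts linearly. Each group axiom then follows
  from the corresponding identity for vectors by passing to classes.\<close>

lemma comm_group_symmetry_group: "comm_group (symmetry_group B)"
proof (rule comm_groupI)
  let ?n = "dim_col B"
  let ?R = "{r \<in> carrier_vec ?n. integral_vec (rat_mat B *\<^sub>v r)}"
  have B: "rat_mat B \<in> carrier_mat (dim_row B) ?n" by simp
  have add: "r + s \<in> ?R" if "r \<in> ?R" "s \<in> ?R" for r s
    using that by (auto simp: mult_add_distrib_mat_vec[OF B] intro!: integral_vec_add)
  have zero: "0\<^sub>v ?n \<in> ?R" by (auto simp: integral_vec_def)
  have one: "\<one>\<^bsub>symmetry_group B\<^esub> = coset_vec (0\<^sub>v ?n)"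
  proof -
    \<comment> \<open>The unit of a factor group is the subgroup itself, here \<open>\<int>\<close>,
      which is the coset of 0.\<close>
    have "\<one>\<^bsub>rat_mod_int\<^esub> = \<int> #>\<^bsub>rat_add_group\<^esub> 0"
      by (simp add: rat_mod_int_def rat_add_group_coset)
    then show ?thesis by (auto simp: symmetry_group_def coset_vec_def fun_eq_iff)
  qed
  show "\<one>\<^bsub>symmetry_group B\<^esub> \<in> carrier (symmetry_group B)"
    using zero unfolding one carrier_symmetry_group symmetry_set_eq by blast
  fix x assume x: "x \<in> carrier (symmetry_group B)"
  then obtain r where r: "r \<in> ?R" "x = coset_vec r" by (auto simp: symmetry_set_eq)
  show "\<one>\<^bsub>symmetry_group B\<^esub> \<otimes>\<^bsub>symmetry_group B\<^esub> x = x"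
    using r by (simp add: one mult_symmetry_group)
  have "- r \<in> ?R"
    using r(1) by (auto simp: integral_vec_def)
  moreover have "coset_vec (- r) \<otimes>\<^bsub>symmetry_group B\<^esub> x = \<one>\<^bsub>symmetry_group B\<^esub>"
    using r by (simp add: one mult_symmetry_group uminus_l_inv_vec[of r ?n])
  ultimately show "\<exists>y\<in>carrier (symmetry_group B). y \<otimes>\<^bsub>symmetry_group B\<^esub> x = \<one>\<^bsub>symmetry_group B\<^esub>"
    unfolding carrier_symmetry_group symmetry_set_eq by blast
  fix y assume y: "y \<in> carrier (symmetry_group B)"
  then obtain s where s: "s \<in> ?R" "y = coset_vec s" by (auto simp: symmetry_set_eq)
  show "x \<otimes>\<^bsub>symmetry_group B\<^esub> y \<in> carrier (symmetry_group B)"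
    using r s add[OF r(1) s(1)] by (auto simp: symmetry_set_eq mult_symmetry_group)
  show "x \<otimes>\<^bsub>symmetry_group B\<^esub> y = y \<otimes>\<^bsub>symmetry_group B\<^esub> x"
    using r s by (simp add: mult_symmetry_group comm_add_vec[of r ?n s])
  fix z assume z: "z \<in> carrier (symmetry_group B)"
  then obtain t where t: "t \<in> ?R" "z = coset_vec t" by (auto simp: symmetry_set_eq)
  show "x \<otimes>\<^bsub>symmetry_group B\<^esub> y \<otimes>\<^bsub>symmetry_group B\<^esub> z =
      x \<otimes>\<^bsub>symmetry_group B\<^esub> (y \<otimes>\<^bsub>symmetry_group B\<^esub> z)"
    using r s t by (simp add: mult_symmetry_group assoc_add_vec[of r ?n s t])
qed

section \<open>Maps on classes induced by integer matrices\<close>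

text \<open>The map that \<open>Q\<close> induces modulo integral vectors, computed on an
  arbitrarily chosen representative; that the choice does not matter is
  \<open>coset_map_coset_vec\<close>.\<close>

definition coset_map :: "int mat \<Rightarrow> (nat \<Rightarrow> rat set) \<Rightarrow> nat \<Rightarrow> rat set" where
  "coset_map Q g = coset_vec (rat_mat Q *\<^sub>v (SOME r. r \<in> carrier_vec (dim_col Q) \<and> coset_vec r = g))"

text \<open>The chosen representative differs from \<open>r\<close> by an integral vector, and the
  integer matrix \<open>Q\<close> sends that difference to an integral vector again.\<close>

lemma coset_map_coset_vec:
  assumes r: "r \<in> carrier_vec (dim_col Q)"
  shows "coset_map Q (coset_vec r) = coset_vec (rat_mat Q *\<^sub>v r)"
proof -
  define s where "s = (SOME s. s \<in> carrier_vec (dim_col Q) \<and> coset_vec s = coset_vec r)"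
  have s: "s \<in> carrier_vec (dim_col Q)" "coset_vec s = coset_vec r"
    using someI[of "\<lambda>s. s \<in> carrier_vec (dim_col Q) \<and> coset_vec s = coset_vec r" r] r
    by (auto simp: s_def)
  have Q: "rat_mat Q \<in> carrier_mat (dim_row Q) (dim_col Q)" by simp
  have "integral_vec (rat_mat Q *\<^sub>v (s - r))"
    using r s by (intro integral_vec_mult_mat_vec) (auto simp: coset_vec_eq_iff)
  then have "integral_vec (rat_mat Q *\<^sub>v s - rat_mat Q *\<^sub>v r)"
    using r s by (simp add: mult_minus_distrib_mat_vec[OF Q])
  then show ?thesis
    unfolding coset_map_def s_def[symmetric]
    by (subst coset_vec_eq_iff[of _ "dim_row Q"]) (auto intro!: carrier_vecI)
qed

lemma rat_mat_mult:
  assumes "A \<in> carrier_mat l m" "B \<in> carrier_mat m n"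
  shows "rat_mat (A * B) = rat_mat A * rat_mat B"
  using assms by (rule of_int_hom.mat_hom_mult)

lemma rat_mat_mult_vec_left_inverse:
  assumes "P \<in> carrier_mat n n" "P' \<in> carrier_mat n n" "P' * P = 1\<^sub>m n" "r \<in> carrier_vec n"
  shows "rat_mat P' *\<^sub>v (rat_mat P *\<^sub>v r) = r"
proof -
  have "rat_mat P' * rat_mat P = 1\<^sub>m n"
    using rat_mat_mult[OF assms(2,1)] by (simp add: assms(3) of_int_hom.mat_hom_one)
  then show ?thesis
    using assms assoc_mult_mat_vec[of "rat_mat P'" n n "rat_mat P" n r] by simp
qed

text \<open>\<open>invertible_mat\<close> leaves the size of the inverse open. Comparing the numbers
  of columns in the two inverse equations shows that it is n by n.\<close>

lemma invertible_matE:
  assumes "invertible_mat P" "P \<in> carrier_mat n n"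
  obtains P' where "P' \<in> carrier_mat n n" "P' * P = 1\<^sub>m n" "P * P' = 1\<^sub>m n"
proof -
  obtain P' where P': "P * P' = 1\<^sub>m (dim_row P)" "P' * P = 1\<^sub>m (dim_row P')"
    using assms(1) by (auto simp: invertible_mat_def inverts_mat_def)
  have "dim_col P' = n" using arg_cong[OF P'(1), of dim_col] assms(2) by simp
  moreover have "dim_row P' = n" using arg_cong[OF P'(2), of dim_col] assms(2) by simp
  ultimately show ?thesis using P' assms(2) by (intro that[of P']) auto
qed

section \<open>Symmetry groups of equivalent integer matrices\<close>

lemma symmetry_group_equivalent_iso:
  assumes A: "A \<in> carrier_mat m n"
    and P: "P \<in> carrier_mat m m" "invertible_mat P"
    and Q: "Q \<in> carrier_mat n n" "invertible_mat Q"
  shows "symmetry_group (P * A * Q) \<cong> symmetry_group A"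
proof -
  obtain P' where P': "P' \<in> carrier_mat m m" "P' * P = 1\<^sub>m m" "P * P' = 1\<^sub>m m"
    using invertible_matE[OF P(2,1)] .
  obtain Q' where Q': "Q' \<in> carrier_mat n n" "Q' * Q = 1\<^sub>m n" "Q * Q' = 1\<^sub>m n"
    using invertible_matE[OF Q(2,1)] .
  define S where "S = P * A * Q"
  have S: "S \<in> carrier_mat m n" using A P Q by (simp add: S_def)
  note dims = carrier_matD[OF A] carrier_matD[OF S] carrier_matD[OF P(1)] carrier_matD[OF Q(1)]
    carrier_matD[OF P'(1)] carrier_matD[OF Q'(1)]
  let ?RS = "{r \<in> carrier_vec n. integral_vec (rat_mat S *\<^sub>v r)}"
  let ?RA = "{r \<in> carrier_vec n. integral_vec (rat_mat A *\<^sub>v r)}"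
  have Qv: "rat_mat Q *\<^sub>v r \<in> carrier_vec n" "rat_mat Q' *\<^sub>v r \<in> carrier_vec n" for r
    using Q Q' by (auto intro!: carrier_vecI)
  have Q'Q: "rat_mat Q' *\<^sub>v (rat_mat Q *\<^sub>v r) = r" if "r \<in> carrier_vec n" for r
    using rat_mat_mult_vec_left_inverse[OF Q(1) Q'(1,2) that] .
  have QQ': "rat_mat Q *\<^sub>v (rat_mat Q' *\<^sub>v r) = r" if "r \<in> carrier_vec n" for r
    using rat_mat_mult_vec_left_inverse[OF Q'(1) Q(1) Q'(3) that] .
  have S_vec: "rat_mat S *\<^sub>v r = rat_mat P *\<^sub>v (rat_mat A *\<^sub>v (rat_mat Q *\<^sub>v r))"
    if r: "r \<in> carrier_vec n" for r
  proof -
    have "rat_mat S = rat_mat P * rat_mat A * rat_mat Q"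
      unfolding S_def rat_mat_mult[OF mult_carrier_mat[OF P(1) A] Q(1)] rat_mat_mult[OF P(1) A] ..
    then show ?thesis
      using A P Q r Qv by (simp add: assoc_mult_mat_vec[of _ m n _ n] assoc_mult_mat_vec[of _ m m _ n])
  qed
  have R_iff: "r \<in> ?RS \<longleftrightarrow> rat_mat Q *\<^sub>v r \<in> ?RA" if r: "r \<in> carrier_vec n" for r
  proof -
    let ?v = "rat_mat A *\<^sub>v (rat_mat Q *\<^sub>v r)"
    have v: "?v \<in> carrier_vec m" using A by (auto intro!: carrier_vecI)
    \<comment> \<open>From right to left the integer matrix \<open>P\<close> is applied to
      \<open>?v\<close>; from left to right \<open>P'\<close> is applied to \<open>P ?v\<close> and
      gives back \<open>?v\<close>.\<close>
    have "integral_vec (rat_mat P *\<^sub>v ?v) \<longleftrightarrow> integral_vec ?v"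
      using integral_vec_mult_mat_vec[of P ?v] integral_vec_mult_mat_vec[of P' "rat_mat P *\<^sub>v ?v"]
        rat_mat_mult_vec_left_inverse[OF P(1) P'(1,2) v] v dims by auto
    then show ?thesis using r Qv S_vec by simp
  qed
  have map_Q: "coset_map Q (coset_vec r) = coset_vec (rat_mat Q *\<^sub>v r)"
    "coset_map Q' (coset_vec r) = coset_vec (rat_mat Q' *\<^sub>v r)" if "r \<in> carrier_vec n" for r
    using that dims by (auto intro!: coset_map_coset_vec)
  \<comment> \<open>Shared by both directions of the isomorphism: it is instantiated with
    \<open>Q\<close> from \<open>S\<close> to \<open>A\<close> and with \<open>Q'\<close> from
    \<open>A\<close> to \<open>S\<close>. The assumption \<open>R\<close> makes the induced map land
    in the target; linearity of \<open>N\<close> makes it additive.\<close>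
  have homI: "coset_map N \<in> hom (symmetry_group B) (symmetry_group C)"
    if N: "N \<in> carrier_mat n n" and B: "dim_col B = n" and C: "dim_col C = n"
      and R: "\<And>r. r \<in> carrier_vec n \<Longrightarrow> integral_vec (rat_mat B *\<^sub>v r) \<Longrightarrow>
        integral_vec (rat_mat C *\<^sub>v (rat_mat N *\<^sub>v r))" for N B C
  proof (rule homI)
    have N': "rat_mat N \<in> carrier_mat n n" using N by simp
    have map_N: "coset_map N (coset_vec r) = coset_vec (rat_mat N *\<^sub>v r)"
      if "r \<in> carrier_vec n" for r
      using coset_map_coset_vec that N by simp
    have Nv: "rat_mat N *\<^sub>v r \<in> carrier_vec n" for r using N by (auto intro!: carrier_vecI)
    fix x assume "x \<in> carrier (symmetry_group B)"
    then obtain r where r: "r \<in> carrier_vec n" "integral_vec (rat_mat B *\<^sub>v r)" "x = coset_vec r"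
      by (auto simp: symmetry_set_eq B)
    then show "coset_map N x \<in> carrier (symmetry_group C)"
      using R Nv C by (auto simp: symmetry_set_eq map_N)
    fix y assume "y \<in> carrier (symmetry_group B)"
    then obtain s where s: "s \<in> carrier_vec n" "y = coset_vec s"
      by (auto simp: symmetry_set_eq B)
    show "coset_map N (x \<otimes>\<^bsub>symmetry_group B\<^esub> y) =
        coset_map N x \<otimes>\<^bsub>symmetry_group C\<^esub> coset_map N y"
      using r s Nv
      by (simp add: B C mult_symmetry_group map_N mult_add_distrib_mat_vec[OF N'])
  qed
  have "group_isomorphisms (symmetry_group S) (symmetry_group A) (coset_map Q) (coset_map Q')"
    unfolding group_isomorphisms_def
  proof (intro conjI ballI)
    show "coset_map Q \<in> hom (symmetry_group S) (symmetry_group A)"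
      using R_iff by (intro homI Q) (auto simp: dims)
    show "coset_map Q' \<in> hom (symmetry_group A) (symmetry_group S)"
    proof (intro homI Q')
      fix r assume "r \<in> carrier_vec n" "integral_vec (rat_mat A *\<^sub>v r)"
      then show "integral_vec (rat_mat S *\<^sub>v (rat_mat Q' *\<^sub>v r))"
        \<comment> \<open>The equivalence is taken at \<open>Q' r\<close>, where
          \<open>Q (Q' r) = r\<close> turns its right-hand side into the assumption on
          \<open>A r\<close>.\<close>
        using R_iff[OF Qv(2)[of r]] by (simp add: QQ')
    qed (simp_all add: dims)
    show "coset_map Q' (coset_map Q x) = x" if "x \<in> carrier (symmetry_group S)" for x
      using that Qv by (auto simp: symmetry_set_eq dims map_Q Q'Q)
    show "coset_map Q (coset_map Q' x) = x" if "x \<in> carrier (symmetry_group A)" for x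
      using that Qv by (auto simp: symmetry_set_eq dims map_Q QQ')
  qed
  then show ?thesis
    unfolding is_iso_def S_def[symmetric] using group_isomorphisms_imp_iso by blast
qed

section \<open>Finiteness for diagonal matrices\<close>

text \<open>These are the classes killed by \<open>a\<close>, and each is represented by a fraction
  k/a with \<open>0 \<le> k < a\<close>.\<close>

lemma finite_Ints_cosets_of_denominator:
  fixes a :: int
  assumes "a > 0"
  shows "finite {\<int> #>\<^bsub>rat_add_group\<^esub> x | x. of_int a * x \<in> \<int>}"
proof (rule finite_subset)
  show "{\<int> #>\<^bsub>rat_add_group\<^esub> x | x. of_int a * x \<in> \<int>} \<subseteq>
      (\<lambda>k. \<int> #>\<^bsub>rat_add_group\<^esub> (of_int k / of_int a)) ` {0..<a}"
  proof clarify
    fix x :: rat assume "of_int a * x \<in> \<int>"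
    then obtain k where k: "of_int a * x = of_int k" by (auto elim: Ints_cases)
    have "x = of_int k / of_int a" using k assms by (simp add: field_simps)
    \<comment> \<open>Division with remainder: the quotient \<open>k div a\<close> becomes the
      integral difference between \<open>x\<close> and the fraction with numerator
      \<open>k mod a\<close>.\<close>
    also have "of_int k = (of_int a * of_int (k div a) + of_int (k mod a) :: rat)"
      by (metis mult_div_mod_eq of_int_add of_int_mult)
    finally have "x - of_int (k mod a) / of_int a = of_int (k div a)"
      using assms by (simp add: add_divide_distrib)
    then have "\<int> #>\<^bsub>rat_add_group\<^esub> x = \<int> #>\<^bsub>rat_add_group\<^esub> (of_int (k mod a) / of_int a)"
      by (simp add: Ints_coset_eq_iff)
    moreover have "k mod a \<in> {0..<a}" using assms by simp
    ultimately show "\<int> #>\<^bsub>rat_add_group\<^esub> x \<in>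
        (\<lambda>k. \<int> #>\<^bsub>rat_add_group\<^esub> (of_int k / of_int a)) ` {0..<a}" by blast
  qed
qed simp

text \<open>Row \<open>j\<close> confines coordinate \<open>j\<close> to the finitely many classes
  killed by \<open>a j\<close>, so the group lies inside a finite product of finite sets.\<close>

lemma finite_symmetry_set_diagonal:
  fixes a :: "nat \<Rightarrow> int"
  assumes "n \<le> m" "\<forall>i<n. 0 < a i"
  shows "finite (symmetry_set (mat m n (\<lambda>(i, j). if i = j then a i else 0)))"
    (is "finite (symmetry_set ?S)")
proof (rule finite_subset)
  show "symmetry_set ?S \<subseteq> (\<Pi>\<^sub>E j\<in>{..<n}. {\<int> #>\<^bsub>rat_add_group\<^esub> x | x. of_int (a j) * x \<in> \<int>})"
  proof
    fix g assume "g \<in> symmetry_set ?S"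
    then obtain r where r: "r \<in> carrier_vec n" "integral_vec (rat_mat ?S *\<^sub>v r)" "g = coset_vec r"
      by (auto simp: symmetry_set_eq)
    have "of_int (a j) * r $ j \<in> \<int>" if j: "j < n" for j
    proof -
      \<comment> \<open>Row \<open>j\<close> exists because \<open>j < n\<close> and
        \<open>n \<le> m\<close>; its only nonzero entry is \<open>a j\<close>, so the sum collapses
        to one term.\<close>
      have "(rat_mat ?S *\<^sub>v r) $ j = (\<Sum>k = 0..<n. of_int (if j = k then a j else 0) * r $ k)"
        using j r(1) assms(1) by (simp add: scalar_prod_def)
      also have "\<dots> = (\<Sum>k = 0..<n. if j = k then of_int (a j) * r $ k else 0)"
        by (rule sum.cong) auto
      also have "\<dots> = of_int (a j) * r $ j" using j by simp
      finally have "(rat_mat ?S *\<^sub>v r) $ j = of_int (a j) * r $ j" .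
      moreover have "(rat_mat ?S *\<^sub>v r) $ j \<in> \<int>"
        using r(2) j assms(1) by (simp add: integral_vec_def)
      ultimately show ?thesis by simp
    qed
    then show "g \<in> (\<Pi>\<^sub>E j\<in>{..<n}. {\<int> #>\<^bsub>rat_add_group\<^esub> x | x. of_int (a j) * x \<in> \<int>})"
      using r(1,3) by (auto simp: coset_vec_def)
  qed
  show "finite (\<Pi>\<^sub>E j\<in>{..<n}. {\<int> #>\<^bsub>rat_add_group\<^esub> x | x. of_int (a j) * x \<in> \<int>})"
    using assms(2) by (intro finite_PiE finite_Ints_cosets_of_denominator) auto
qed

theorem theorem4p4:
  fixes n :: nat and W :: cpoly and A S :: "int mat"
  assumes "admissible n W"
    and "is_exponent_matrix n W A"
    and "is_smith_normal_form A S"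
  shows "comm_group (symmetry_group S) \<and> finite (carrier (symmetry_group S)) \<and>
         comm_group (symmetry_group A) \<and> finite (carrier (symmetry_group A)) \<and>
         symmetry_group S \<cong> symmetry_group A"
proof -
  \<comment> \<open>The normal form gives two descriptions of \<open>S\<close>: the product
    \<open>P * A * Q\<close> yields the isomorphism, and the diagonal shape with positive entries
    yields finiteness.\<close>
  obtain P Q a where PQ: "P \<in> carrier_mat (dim_row A) (dim_row A)" "invertible_mat P"
      "Q \<in> carrier_mat (dim_col A) (dim_col A)" "invertible_mat Q" "S = P * A * Q"
    and a: "dim_col A \<le> dim_row A" "\<forall>i<dim_col A. 0 < a i"
      "S = mat (dim_row A) (dim_col A) (\<lambda>(i, j). if i = j then a i else 0)"
    using assms(3) unfolding is_smith_normal_form_def Let_def by blast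
  have iso: "symmetry_group S \<cong> symmetry_group A"
    unfolding PQ(5) using PQ(1-4) by (intro symmetry_group_equivalent_iso) auto
  have finS: "finite (carrier (symmetry_group S))"
    unfolding a(3) carrier_symmetry_group using a(1,2) by (rule finite_symmetry_set_diagonal)
  \<comment> \<open>Finiteness has been read off on the diagonal side; the bijection underlying the
    isomorphism carries it over to \<open>A\<close>.\<close>
  obtain h where "bij_betw h (carrier (symmetry_group S)) (carrier (symmetry_group A))"
    using iso by (auto simp: is_iso_def iso_def)
  with finS have "finite (carrier (symmetry_group A))" using bij_betw_finite by blast
  with iso finS show ?thesis using comm_group_symmetry_group by blast
qed

end
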